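(* Let $f(z)=\sum_{k\ge0}a_kz^k$ be a transcendental analytic function on (a neighbourhood of) $D_1$ with $f(0)=0$ and $|f|\le1$ on $D_1$. Assume that all Taylor coefficients $a_k$ are rational and that there exist polynomials $R$ and $S$ with positive coefficients such that $$\nu_d\le R(d)\quad\text{and}\quad h_l\le e^{S(l)}\qquad\text{for all } d,l\ge1.$$ Then there exists a polynomial $T$ such that $\mathcal{Z}_d(f)\le T(d)$ for all $d\ge 1$, where $\mathcal{Z}_d(f)$ counts zeroes in the disc $D_{1/4}$.
   Context: $D_r=\{z\in\mathbb{C}:|z|\le r\}$. An analytic function $f$ is transcendental if $P(z,f(z))\not\equiv0$ for every non-zero $P\in\mathbb{C}[X,Y]$. Write $a_k=m_k/p_k$ with $m_k\in\mathbb{Z}$, $p_k\in\mathbb{Z}_{>0}$ coprime; for $l\ge1$ put $h_l=\max\{p_k: k=1,\dots,l\}$. The $d$-th transcendence index $\nu_d$ of $f$ is the maximal order of vanishing at $0$ of $P(z,f(z))$ over all non-zero $P\in\mathbb{C}[X,Y]$ of total degree at most $d$. $\mathcal{Z}_d(f)$ is the maximum, over all $(p_0,\dots,p_d)\ne(0,\dots,0)$ with $p_j\in\mathbb{C}[z]$, $\deg p_j\le d$, of the number of zeroes (with multiplicity) in $D_{1/4}$ of $\sum_{j=0}^dp_j(z)f(z)^j$. *)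

theory Defs
  imports "HOL-Complex_Analysis.Complex_Analysis"
begin

text \<open>
  A bivariate polynomial is a \<^typ>\<open>complex poly poly\<close>: the outer variable is \<open>Y\<close>, and the
  coefficient of \<open>Y ^ j\<close> is a polynomial in \<open>X\<close>. Hence \<open>P(z, w)\<close> is \<open>poly (poly P [:w:]) z\<close>.
\<close>

definition total_degree_le :: "complex poly poly \<Rightarrow> nat \<Rightarrow> bool" where
  "total_degree_le P d \<longleftrightarrow> (\<forall>i j. coeff (coeff P j) i \<noteq> 0 \<longrightarrow> i + j \<le> d)"

definition transcendental_on :: "(complex \<Rightarrow> complex) \<Rightarrow> complex set \<Rightarrow> bool" where
  "transcendental_on f D \<longleftrightarrow>
     (\<forall>P :: complex poly poly. P \<noteq> 0 \<longrightarrow> (\<exists>z\<in>D. poly (poly P [:f z:]) z \<noteq> 0))"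

text \<open>
  The value of \<^const>\<open>zorder\<close> is unspecified for a function that vanishes identically near the
  point, so that case gets the order \<open>\<infinity>\<close>.
\<close>

definition vanishing_order :: "(complex \<Rightarrow> complex) \<Rightarrow> complex \<Rightarrow> enat" where
  "vanishing_order g z =
     (if eventually (\<lambda>w. g w = 0) (nhds z) then \<infinity> else enat (nat (zorder g z)))"

definition zero_count :: "(complex \<Rightarrow> complex) \<Rightarrow> complex set \<Rightarrow> enat" where
  "zero_count g D =
     (if finite {z\<in>D. g z = 0} then (\<Sum>z\<in>{z\<in>D. g z = 0}. vanishing_order g z) else \<infinity>)"

text \<open>
  The two maxima below are suprema in \<^typ>\<open>enat\<close>, so that a finite upper bound on them really
  bounds every member of the family; a finite supremum is attained.
\<close>

definition transcendence_index :: "(complex \<Rightarrow> complex) \<Rightarrow> nat \<Rightarrow> enat" where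
  "transcendence_index f d =
     (SUP P\<in>{P :: complex poly poly. P \<noteq> 0 \<and> total_degree_le P d}.
        vanishing_order (\<lambda>z. poly (poly P [:f z:]) z) 0)"

definition max_zero_count :: "(complex \<Rightarrow> complex) \<Rightarrow> nat \<Rightarrow> enat" where
  "max_zero_count f d =
     (SUP p\<in>{p :: nat \<Rightarrow> complex poly. (\<exists>j\<le>d. p j \<noteq> 0) \<and> (\<forall>j\<le>d. degree (p j) \<le> d)}.
        zero_count (\<lambda>z. \<Sum>j\<le>d. poly (p j) z * f z ^ j) (cball 0 (1/4)))"

text \<open>\<^const>\<open>quotient_of\<close> returns the reduced fraction with positive denominator.\<close>

definition max_denominator :: "(nat \<Rightarrow> rat) \<Rightarrow> nat \<Rightarrow> int" where
  "max_denominator a l = Max ((\<lambda>k. snd (quotient_of (a k))) ` {1..l})"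

definition positive_coeffs :: "real poly \<Rightarrow> bool" where
  "positive_coeffs p \<longleftrightarrow> (\<forall>i\<le>degree p. coeff p i > 0)"

end

theory Submission
  imports Defs "Jordan_Normal_Form.Determinant"
begin

text \<open>
  Let \<open>F(z) = P(z, f(z))\<close> with coefficient family \<open>c\<close>, and let \<open>m\<close> bound the transcendence index of
  degree \<open>2d\<close>. The linear map sending \<open>c\<close> to the Taylor coefficients of \<open>F\<close> up to order \<open>m\<close> is
  injective. Its matrix entries have modulus at most 1 by Cauchy's inequality, and they become
  integers after multiplication by the \<open>d\<close>-th power of a common denominator \<open>Q\<close> of the \<open>a\<close>'s. A
  nonzero integer determinant is at least 1 in modulus, so Cramer's rule bounds the sum \<open>C\<close> of the
  moduli of the \<open>c\<close>'s by \<open>K\<close> times the largest of these Taylor coefficients, with \<open>ln K\<close> polynomial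
  in \<open>d\<close>. If \<open>F\<close> has \<open>N\<close> zeros in the disc of radius 1/4, then \<open>F\<close> is at most \<open>C * (4/5)^N\<close> there, so
  by Cauchy's inequality the Taylor coefficients are at most \<open>C * (4/5)^N * 4^m\<close>. Comparing the two
  estimates gives \<open>(5/4)^N \<le> K * 4^m\<close>.
\<close>

section \<open>Size estimates for integer matrices and integer linear systems\<close>

text \<open>The Leibniz formula has \<open>n!\<close> terms, each a product of \<open>n\<close>
  entries. This is cruder than Hadamard's inequality, but only the logarithm of the bound matters
  later, and it stays polynomial in \<open>n\<close> and \<open>ln h\<close>.\<close>

lemma abs_det_le:
  fixes A :: "int mat"
  assumes "A \<in> carrier_mat n n" and "\<And>i j. i < n \<Longrightarrow> j < n \<Longrightarrow> \<bar>A $$ (i, j)\<bar> \<le> h"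
  shows "\<bar>det A\<bar> \<le> fact n * h ^ n"
proof -
  have "\<bar>det A\<bar> \<le> (\<Sum>p | p permutes {0..<n}. \<bar>signof p * (\<Prod>i=0..<n. A $$ (i, p i))\<bar>)"
    unfolding det_def'[OF assms(1)] by (rule sum_abs)
  also have "\<dots> \<le> (\<Sum>p | p permutes {0..<n}. h ^ n)"
  proof (rule sum_mono)
    fix p assume "p \<in> {p. p permutes {0..<n}}"
    then have p: "p permutes {0..<n}" by simp
    have "\<bar>signof p * (\<Prod>i=0..<n. A $$ (i, p i))\<bar> = (\<Prod>i=0..<n. \<bar>A $$ (i, p i)\<bar>)"
      by (simp add: abs_mult abs_prod sign_def)
    also have "\<dots> \<le> (\<Prod>i=0..<n. h)"
      using permutes_in_image[OF p] by (intro prod_mono) (auto intro!: assms(2))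
    finally show "\<bar>signof p * (\<Prod>i=0..<n. A $$ (i, p i))\<bar> \<le> h ^ n" by simp
  qed
  also have "\<dots> = fact n * h ^ n"
    by (simp add: card_permutations[of "{0..<n}" n])
  finally show ?thesis .
qed

text \<open>Up to sign, an entry of the adjugate is a minor of size \<open>n - 1\<close>, so the
  Leibniz bound applies; \<open>1 \<le> h\<close> allows the exponent to be raised to
  \<open>n\<close>.\<close>

lemma abs_adj_mat_le:
  fixes A :: "int mat"
  assumes A: "A \<in> carrier_mat n n" and le: "\<And>i j. i < n \<Longrightarrow> j < n \<Longrightarrow> \<bar>A $$ (i, j)\<bar> \<le> h"
    and "1 \<le> h" and ij: "i < n" "j < n"
  shows "\<bar>adj_mat A $$ (i, j)\<bar> \<le> fact n * h ^ n"
proof -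
  have "\<bar>adj_mat A $$ (i, j)\<bar> = \<bar>det (mat_delete A j i)\<bar>"
    using A ij by (simp add: adj_mat_def cofactor_def abs_mult power_abs)
  also have "\<dots> \<le> fact (n - 1) * h ^ (n - 1)"
  proof (rule abs_det_le)
    show "mat_delete A j i \<in> carrier_mat (n - 1) (n - 1)"
      using A by (rule mat_delete_carrier)
    fix k l assume "k < n - 1" "l < n - 1"
    then show "\<bar>mat_delete A j i $$ (k, l)\<bar> \<le> h"
      using A ij le by (auto simp: mat_delete_def)
  qed
  also have "\<dots> \<le> fact n * h ^ n"
    using \<open>1 \<le> h\<close> by (intro mult_mono fact_mono power_increasing) auto
  finally show ?thesis .
qed

text \<open>
  The Gram matrix of an integer matrix of full rank has a nonzero integer determinant, hence one of
  absolute value at least 1, and its adjugate then bounds the inverse.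
\<close>

lemma integer_system_bound:
  fixes U :: "nat \<Rightarrow> nat \<Rightarrow> int" and H :: int and x :: "nat \<Rightarrow> complex"
  assumes inj: "\<And>v :: nat \<Rightarrow> complex.
      (\<And>k. k < m \<Longrightarrow> (\<Sum>i<n. of_int (U i k) * v i) = 0) \<Longrightarrow> (\<And>i. i < n \<Longrightarrow> v i = 0)"
    and U: "\<And>i k. i < n \<Longrightarrow> k < m \<Longrightarrow> \<bar>U i k\<bar> \<le> H"
    and H: "1 \<le> H" and m: "1 \<le> m"
    and x: "\<And>k. k < m \<Longrightarrow> norm (\<Sum>i<n. of_int (U i k) * x i) \<le> \<beta>"
    and i: "i < n"
  shows "norm (x i) \<le> real n * (fact n * (real m * real_of_int H ^ 2) ^ n) * (real m * real_of_int H * \<beta>)"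
proof -
  define G where "G = mat n n (\<lambda>(i, j). \<Sum>k<m. U i k * U j k)"
  have G: "G \<in> carrier_mat n n" and
    G_nth: "\<And>i j. i < n \<Longrightarrow> j < n \<Longrightarrow> G $$ (i, j) = (\<Sum>k<m. U i k * U j k)"
    by (auto simp: G_def)
  have G_le: "\<bar>G $$ (i, j)\<bar> \<le> int m * H ^ 2" if "i < n" "j < n" for i j
  proof -
    have "\<bar>G $$ (i, j)\<bar> \<le> (\<Sum>k<m. \<bar>U i k\<bar> * \<bar>U j k\<bar>)"
      using that by (simp add: G_nth flip: abs_mult)
    also have "\<dots> \<le> (\<Sum>k<m. H * H)"
      using U that H by (intro sum_mono mult_mono) auto
    finally show ?thesis by (simp add: power2_eq_square)
  qed
  have mH: "1 \<le> int m * H ^ 2"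
    using m H by (smt (verit) mult_pos_pos of_nat_1 of_nat_mono zero_less_power)
  have "det G \<noteq> 0"
  proof
    assume "det G = 0"
    then obtain v where v: "v \<in> carrier_vec n" "v \<noteq> 0\<^sub>v n" "G *\<^sub>v v = 0\<^sub>v n"
      using det_0_iff_vec_prod_zero[OF G] by blast
    have zero: "(\<Sum>j<n. G $$ (i, j) * vec_index v j) = 0" if "i < n" for i
    proof -
      have "vec_index (G *\<^sub>v v) i = (\<Sum>j<n. G $$ (i, j) * vec_index v j)"
        using that G v(1) by (simp add: scalar_prod_def lessThan_atLeast0)
      then show ?thesis using v(3) that by simp
    qed
    \<comment> \<open>The quadratic form of \<open>G\<close> at \<open>v\<close> is a sum of
      squares. Since \<open>v\<close> is an integer kernel vector, these squares are nonnegative and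
      sum to 0, so \<open>v\<close> solves the homogeneous system and contradicts
      \<open>inj\<close>.\<close>
    have "(\<Sum>k<m. (\<Sum>i<n. U i k * vec_index v i) ^ 2)
        = (\<Sum>k<m. \<Sum>i<n. \<Sum>j<n. vec_index v i * (U i k * U j k * vec_index v j))"
      by (simp add: power2_eq_square sum_product ac_simps)
    also have "\<dots> = (\<Sum>i<n. \<Sum>k<m. \<Sum>j<n. vec_index v i * (U i k * U j k * vec_index v j))"
      by (rule sum.swap)
    also have "\<dots> = (\<Sum>i<n. \<Sum>j<n. \<Sum>k<m. vec_index v i * (U i k * U j k * vec_index v j))"
      by (intro sum.cong refl sum.swap)
    also have "\<dots> = (\<Sum>i<n. vec_index v i * (\<Sum>j<n. G $$ (i, j) * vec_index v j))"
      by (simp add: G_nth sum_distrib_left sum_distrib_right)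
    also have "\<dots> = 0" by (simp add: zero)
    finally have sq: "\<forall>k\<in>{..<m}. (\<Sum>i<n. U i k * vec_index v i) ^ 2 = 0"
      by (subst (asm) sum_nonneg_eq_0_iff) auto
    have "of_int (vec_index v i) = (0 :: complex)" if "i < n" for i
    proof (rule inj[OF _ that])
      fix k assume "k < m"
      have "(\<Sum>i<n. of_int (U i k) * (of_int (vec_index v i) :: complex))
          = of_int (\<Sum>i<n. U i k * vec_index v i)" by simp
      also have "(\<Sum>i<n. U i k * vec_index v i) = 0" using sq \<open>k < m\<close> by simp
      finally show "(\<Sum>i<n. of_int (U i k) * (of_int (vec_index v i) :: complex)) = 0" by simp
    qed
    then have "v = 0\<^sub>v n" using v(1) by (intro eq_vecI) auto
    with v(2) show False by simp
  qed
  \<comment> \<open>The normal equations: \<open>w\<close> is \<open>U\<close> applied to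
    \<open>y\<close>, which equals \<open>G\<close> applied to \<open>x\<close>. Multiplying by the
    adjugate of \<open>G\<close> isolates \<open>det G * x i\<close>.\<close>
  define y where "y k = (\<Sum>i<n. of_int (U i k) * x i)" for k
  define w where "w j = (\<Sum>k<m. of_int (U j k) * y k)" for j
  have w: "w j = (\<Sum>l<n. of_int (G $$ (j, l)) * x l)" if "j < n" for j
  proof -
    have "w j = (\<Sum>k<m. \<Sum>l<n. of_int (U j k * U l k) * x l)"
      by (simp add: w_def y_def sum_distrib_left ac_simps)
    also have "\<dots> = (\<Sum>l<n. \<Sum>k<m. of_int (U j k * U l k) * x l)" by (rule sum.swap)
    finally show ?thesis using that by (simp add: G_nth sum_distrib_right)
  qed
  have adj: "(\<Sum>j<n. adj_mat G $$ (i, j) * G $$ (j, l)) = (if l = i then det G else 0)" if "l < n" for l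
  proof -
    have "(adj_mat G * G) $$ (i, l) = (\<Sum>j<n. adj_mat G $$ (i, j) * G $$ (j, l))"
      using that i G adj_mat(1)[OF G] by (simp add: scalar_prod_def lessThan_atLeast0)
    moreover have "(adj_mat G * G) $$ (i, l) = (if l = i then det G else 0)"
      using that i by (simp add: adj_mat(3)[OF G])
    ultimately show ?thesis by simp
  qed
  have "(\<Sum>j<n. of_int (adj_mat G $$ (i, j)) * w j)
      = (\<Sum>j<n. \<Sum>l<n. of_int (adj_mat G $$ (i, j) * G $$ (j, l)) * x l)"
    by (simp add: w sum_distrib_left ac_simps)
  also have "\<dots> = (\<Sum>l<n. of_int (\<Sum>j<n. adj_mat G $$ (i, j) * G $$ (j, l)) * x l)"
    by (subst sum.swap) (simp add: sum_distrib_right)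
  also have "\<dots> = (\<Sum>l<n. if l = i then of_int (det G) * x l else 0)"
    by (intro sum.cong refl) (simp add: adj del: of_int_sum)
  also have "\<dots> = of_int (det G) * x i" using i by simp
  finally have solve: "of_int (det G) * x i = (\<Sum>j<n. of_int (adj_mat G $$ (i, j)) * w j)" ..
  have w_le: "norm (w j) \<le> real m * real_of_int H * \<beta>" if "j < n" for j
  proof -
    have "norm (w j) \<le> (\<Sum>k<m. norm (of_int (U j k) :: complex) * norm (y k))"
      unfolding w_def by (rule order_trans[OF norm_sum]) (simp add: norm_mult)
    also have "\<dots> \<le> (\<Sum>k<m. real_of_int H * \<beta>)"
    proof (intro sum_mono mult_mono)
      fix k assume k: "k \<in> {..<m}"
      have "real_of_int \<bar>U j k\<bar> \<le> real_of_int H"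
        using U[OF that] k by (simp only: of_int_le_iff) auto
      then show "norm (of_int (U j k) :: complex) \<le> real_of_int H" by simp
      show "norm (y k) \<le> \<beta>" using x k by (simp add: y_def)
    qed (use H in auto)
    finally show ?thesis by simp
  qed
  have "1 \<le> \<bar>real_of_int (det G)\<bar>" using \<open>det G \<noteq> 0\<close> by linarith
  then have "norm (x i) \<le> \<bar>real_of_int (det G)\<bar> * norm (x i)"
    by (simp add: mult_le_cancel_right1)
  also have "\<dots> = norm (\<Sum>j<n. of_int (adj_mat G $$ (i, j)) * w j)"
    by (simp add: norm_mult flip: solve)
  also have "\<dots> \<le> (\<Sum>j<n. \<bar>real_of_int (adj_mat G $$ (i, j))\<bar> * norm (w j))"
    by (rule order_trans[OF norm_sum]) (simp add: norm_mult)
  also have "\<dots> \<le> (\<Sum>j<n. (fact n * (real m * real_of_int H ^ 2) ^ n) * (real m * real_of_int H * \<beta>))"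
  proof (intro sum_mono mult_mono)
    fix j assume j: "j \<in> {..<n}"
    have "\<bar>adj_mat G $$ (i, j)\<bar> \<le> fact n * (int m * H ^ 2) ^ n"
      using abs_adj_mat_le[OF G G_le mH i] j by simp
    then have "real_of_int \<bar>adj_mat G $$ (i, j)\<bar> \<le> real_of_int (fact n * (int m * H ^ 2) ^ n)"
      by (simp only: of_int_le_iff)
    then show "\<bar>real_of_int (adj_mat G $$ (i, j))\<bar> \<le> fact n * (real m * real_of_int H ^ 2) ^ n"
      by simp
    show "norm (w j) \<le> real m * real_of_int H * \<beta>" using w_le j by simp
  qed (use H in auto)
  finally show ?thesis by simp
qed

section \<open>Dividing out zeros, and smallness of functions with many zeros\<close>

text \<open>The quotient of \<open>F\<close> by the product of the factors is holomorphic off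
  \<open>Z\<close>, and the local factorization of \<open>F\<close> at each point of
  \<open>Z\<close> makes every singularity removable. Points of \<open>Z\<close> where
  \<open>F\<close> is nonzero have order 0 and do no harm.\<close>

lemma zorder_factorization:
  fixes F :: "complex \<Rightarrow> complex"
  assumes F: "F holomorphic_on S" and S: "open S" "connected S" and nz: "\<exists>w\<in>S. F w \<noteq> 0"
    and Z: "finite Z" "Z \<subseteq> S"
  obtains G where "G holomorphic_on S"
    and "\<And>w. w \<in> S \<Longrightarrow> F w = G w * (\<Prod>\<zeta>\<in>Z. (w - \<zeta>) ^ nat (zorder F \<zeta>))"
proof -
  define m where "m \<zeta> = nat (zorder F \<zeta>)" for \<zeta>
  define Q where "Q A w = (\<Prod>\<zeta>\<in>A. (w - \<zeta>) ^ m \<zeta>)" for A and w :: complex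
  define g where "g = zor_poly F"
  \<comment> \<open>At a point of \<open>Z\<close> the factor \<open>(v - w) ^ m w\<close> cancels
    against the local factorization \<open>F v = g w v * (v - w) ^ m w\<close>, so the value chosen
    there is the limit of \<open>F / Q Z\<close>.\<close>
  define G where "G w = (if w \<in> Z then g w w / Q (Z - {w}) w else F w / Q Z w)" for w
  have Q_split: "Q Z w = (w - \<zeta>) ^ m \<zeta> * Q (Z - {\<zeta>}) w" if "\<zeta> \<in> Z" for \<zeta> w
    unfolding Q_def using that Z(1) by (simp add: prod.remove)
  have Q_nz: "Q A w \<noteq> 0" if "w \<notin> A" "A \<subseteq> Z" for A w
    using that finite_subset[OF that(2) Z(1)] by (auto simp: Q_def)
  have Q_holo: "Q A holomorphic_on T" for A T
    unfolding Q_def by (intro holomorphic_intros)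
  have loc: "\<exists>r>0. cball \<zeta> r \<subseteq> S \<and> g \<zeta> holomorphic_on cball \<zeta> r
      \<and> (\<forall>w\<in>cball \<zeta> r. F w = g \<zeta> w * (w - \<zeta>) ^ m \<zeta>)" if "\<zeta> \<in> Z" for \<zeta>
    using zorder_exist_zero[OF F S _ nz, of \<zeta>] that Z(2) unfolding g_def m_def by blast
  have "G holomorphic_on S"
  proof (rule no_isolated_singularity'[OF _ _ S(1) Z(1)])
    have "(\<lambda>w. F w / Q Z w) holomorphic_on S - Z"
      using holomorphic_on_subset[OF F] Q_nz by (intro holomorphic_intros Q_holo) auto
    then show "G holomorphic_on S - Z"
      by (rule holomorphic_transform) (auto simp: G_def)
  next
    fix \<zeta> assume \<zeta>: "\<zeta> \<in> Z"
    obtain r where r: "r > 0" "g \<zeta> holomorphic_on cball \<zeta> r"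
      "\<And>w. w \<in> cball \<zeta> r \<Longrightarrow> F w = g \<zeta> w * (w - \<zeta>) ^ m \<zeta>"
      using loc[OF \<zeta>] by blast
    have "isCont (g \<zeta>) \<zeta>"
      using continuous_on_interior[OF holomorphic_on_imp_continuous_on[OF r(2)]] r(1)
      by (simp add: interior_cball)
    moreover have "isCont (Q (Z - {\<zeta>})) \<zeta>"
      using Q_holo[of _ UNIV] holomorphic_on_imp_continuous_on continuous_on_eq_continuous_at by blast
    ultimately have "((\<lambda>w. g \<zeta> w / Q (Z - {\<zeta>}) w) \<longlongrightarrow> g \<zeta> \<zeta> / Q (Z - {\<zeta>}) \<zeta>) (at \<zeta>)"
      using Q_nz[of \<zeta> "Z - {\<zeta>}"] by (intro tendsto_divide) (auto simp: isCont_def)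
    moreover have "eventually (\<lambda>w. g \<zeta> w / Q (Z - {\<zeta>}) w = G w) (at \<zeta>)"
    proof -
      have "eventually (\<lambda>w. w \<in> ball \<zeta> r - {\<zeta>}) (at \<zeta>)"
        using r(1) by (intro eventually_at_in_open) auto
      moreover have "open (- (Z - {\<zeta>}))"
        using Z(1) by (intro open_Compl finite_imp_closed) auto
      then have "eventually (\<lambda>w. w \<in> - (Z - {\<zeta>}) - {\<zeta>}) (at \<zeta>)"
        by (intro eventually_at_in_open) auto
      ultimately show ?thesis
      proof eventually_elim
        case (elim w)
        then show ?case using r(3)[of w] Q_split[OF \<zeta>] by (auto simp: G_def)
      qed
    qed
    ultimately have "(G \<longlongrightarrow> g \<zeta> \<zeta> / Q (Z - {\<zeta>}) \<zeta>) (at \<zeta>)"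
      by (rule Lim_transform_eventually)
    then show "(G \<longlongrightarrow> G \<zeta>) (at \<zeta> within S)"
      using \<zeta> by (auto simp: G_def intro: Lim_at_imp_Lim_at_within)
  qed
  moreover have "F w = G w * (\<Prod>\<zeta>\<in>Z. (w - \<zeta>) ^ nat (zorder F \<zeta>))" if "w \<in> S" for w
  proof (cases "w \<in> Z")
    case True
    then obtain r where "r > 0" "\<forall>v\<in>cball w r. F v = g w v * (v - w) ^ m w"
      using loc by blast
    then have "F w = g w w * (w - w) ^ m w" by simp
    then have "F w = G w * Q Z w"
      using True Q_nz[of w "Z - {w}"] by (simp add: G_def Q_split)
    then show ?thesis by (simp add: Q_def m_def)
  next
    case False
    then have "F w = G w * Q Z w" using Q_nz[of w Z] by (simp add: G_def)
    then show ?thesis by (simp add: Q_def m_def)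
  qed
  ultimately show ?thesis by (rule that)
qed

text \<open>
  Each zero in the small disc contributes a factor of modulus at least 5/8 on the circle of radius
  7/8 and at most 1/2 on the small disc; the quotient 4/5 of the two bounds is what matters.
\<close>

lemma norm_le_zeros:
  fixes F :: "complex \<Rightarrow> complex"
  assumes F: "F holomorphic_on ball 0 1" and nz: "\<exists>w\<in>ball 0 1. F w \<noteq> 0"
    and B: "\<And>w. w \<in> ball 0 1 \<Longrightarrow> norm (F w) \<le> B"
    and Z: "finite Z" "Z \<subseteq> cball 0 (1/4)" and z: "z \<in> cball 0 (1/4)"
  shows "norm (F z) \<le> B * (4/5) ^ (\<Sum>\<zeta>\<in>Z. nat (zorder F \<zeta>))"
proof -
  define n where "n = (\<Sum>\<zeta>\<in>Z. nat (zorder F \<zeta>))"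
  have "Z \<subseteq> ball 0 1" using Z(2) by force
  then obtain G where G: "G holomorphic_on ball 0 1"
    and FG: "\<And>w. w \<in> ball 0 1 \<Longrightarrow> F w = G w * (\<Prod>\<zeta>\<in>Z. (w - \<zeta>) ^ nat (zorder F \<zeta>))"
    using zorder_factorization[OF F open_ball connected_ball nz Z(1)] by blast
  have B0: "0 \<le> B" using B[of 0] by (smt (verit) centre_in_ball norm_ge_zero)
  have "norm (G z) \<le> B / (5/8) ^ n"
  \<comment> \<open>The bound for \<open>G\<close> is easy on a circle away from \<open>Z\<close>,
    and the maximum principle carries it inwards to \<open>z\<close>. The radius stays below 1
    because \<open>F\<close> is controlled only on the open disc.\<close>
  proof (rule maximum_modulus_frontier[where f = G and S = "cball (0::complex) (7/8)"])
    show "G holomorphic_on interior (cball (0::complex) (7/8))"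
      by (rule holomorphic_on_subset[OF G]) auto
    show "continuous_on (closure (cball (0::complex) (7/8))) G"
      by (rule continuous_on_subset[OF holomorphic_on_imp_continuous_on[OF G]]) auto
    show "bounded (cball (0::complex) (7/8))" by simp
    show "z \<in> cball 0 (7/8)" using z by simp
    fix w :: complex assume "w \<in> frontier (cball 0 (7/8))"
    then have w: "norm w = 7/8" by simp
    have "(5/8) ^ n = (\<Prod>\<zeta>\<in>Z. (5/8 :: real) ^ nat (zorder F \<zeta>))"
      by (simp add: n_def power_sum)
    also have "\<dots> \<le> (\<Prod>\<zeta>\<in>Z. norm (w - \<zeta>) ^ nat (zorder F \<zeta>))"
    proof (intro prod_mono conjI power_mono)
      fix \<zeta> assume "\<zeta> \<in> Z"
      then have "norm \<zeta> \<le> 1/4" using Z(2) by auto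
      then show "5/8 \<le> norm (w - \<zeta>)" using w norm_triangle_ineq2[of w \<zeta>] by simp
    qed auto
    finally have "(5/8) ^ n \<le> (\<Prod>\<zeta>\<in>Z. norm (w - \<zeta>) ^ nat (zorder F \<zeta>))" .
    then have "norm (G w) * (5/8) ^ n \<le> norm (G w) * (\<Prod>\<zeta>\<in>Z. norm (w - \<zeta>) ^ nat (zorder F \<zeta>))"
      by (rule mult_left_mono) simp
    also have "\<dots> = norm (F w)"
      using w by (simp add: FG norm_mult norm_power flip: prod_norm)
    also have "\<dots> \<le> B" using w by (intro B) simp
    finally show "norm (G w) \<le> B / (5/8) ^ n" by (simp add: field_simps)
  qed
  moreover have "(\<Prod>\<zeta>\<in>Z. norm (z - \<zeta>) ^ nat (zorder F \<zeta>)) \<le> (1/2) ^ n"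
  proof -
    have "(\<Prod>\<zeta>\<in>Z. norm (z - \<zeta>) ^ nat (zorder F \<zeta>)) \<le> (\<Prod>\<zeta>\<in>Z. (1/2) ^ nat (zorder F \<zeta>))"
    proof (intro prod_mono conjI power_mono)
      fix \<zeta> assume "\<zeta> \<in> Z"
      then have "norm \<zeta> \<le> 1/4" using Z(2) by auto
      then show "norm (z - \<zeta>) \<le> 1/2" using z norm_triangle_ineq4[of z \<zeta>] by simp
    qed auto
    then show ?thesis by (simp add: n_def power_sum)
  qed
  ultimately have "norm (G z) * (\<Prod>\<zeta>\<in>Z. norm (z - \<zeta>) ^ nat (zorder F \<zeta>)) \<le> B / (5/8) ^ n * (1/2) ^ n"
    using B0 by (intro mult_mono prod_nonneg) auto
  also have "\<dots> = B * (4/5) ^ n" by (simp add: power_divide field_simps flip: power_mult_distrib)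
  also have "norm (G z) * (\<Prod>\<zeta>\<in>Z. norm (z - \<zeta>) ^ nat (zorder F \<zeta>)) = norm (F z)"
    using z by (simp add: FG norm_mult norm_power flip: prod_norm)
  finally show ?thesis by (simp add: n_def)
qed

section \<open>Taylor coefficients: vanishing order, size and denominators\<close>

text \<open>Turns the bound on the transcendence index into a statement about Taylor coefficients;
  the case \<open>E = 0\<close> is the infinite branch of \<open>vanishing_order\<close>, by
  uniqueness of the expansion.\<close>

lemma vanishing_order_eq_subdegree:
  assumes "F has_fps_expansion E"
  shows "vanishing_order F 0 = (if E = 0 then \<infinity> else enat (subdegree E))"
proof (cases "E = 0")
  case True
  then show ?thesis
    using assms by (auto simp: vanishing_order_def has_fps_expansion_0_iff)
next
  case False
  have "\<not> eventually (\<lambda>w. F w = 0) (nhds 0)"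
  proof
    assume "eventually (\<lambda>w. F w = 0) (nhds 0)"
    then have "F has_fps_expansion 0" by (simp add: has_fps_expansion_0_iff)
    then show False using assms False fps_expansion_unique_complex by blast
  qed
  then show ?thesis
    using False has_fps_expansion_zorder_0[OF assms False] by (simp add: vanishing_order_def)
qed

text \<open>Cauchy's inequality. It is used with radius 1 for the matrix entries and with radius
  1/4, at the cost of \<open>4 ^ k\<close>, for a function known to be small near 0.\<close>

lemma norm_fps_nth_le:
  fixes F :: "complex \<Rightarrow> complex"
  assumes E: "F has_fps_expansion E" and F: "F holomorphic_on ball 0 r" "continuous_on (cball 0 r) F"
    and r: "0 < r" and B: "\<And>z. norm z = r \<Longrightarrow> norm (F z) \<le> B"
  shows "norm (fps_nth E k) \<le> B / r ^ k"
proof -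
  have "norm ((deriv ^^ k) F 0) \<le> fact k * B / r ^ k"
    using Cauchy_inequality[OF F r, of B k] B by simp
  then show ?thesis
    by (simp add: fps_nth_fps_expansion[OF E] norm_divide field_simps)
qed

text \<open>A coefficient of \<open>A ^ j\<close> is a sum of products of \<open>j\<close>
  coefficients of \<open>A\<close> with indices at most \<open>k\<close>, and each of these absorbs
  one factor \<open>q\<close>.\<close>

lemma fps_nth_power_Ints:
  fixes A :: "'a :: field_char_0 fps"
  assumes "\<And>k. k \<le> m \<Longrightarrow> q * fps_nth A k \<in> \<int>" and "k \<le> m"
  shows "q ^ j * fps_nth (A ^ j) k \<in> \<int>"
  using assms(2)
proof (induction j arbitrary: k)
  case 0
  then show ?case by simp
next
  case (Suc j)
  have "q ^ Suc j * fps_nth (A ^ Suc j) k = (\<Sum>i=0..k. (q * fps_nth A i) * (q ^ j * fps_nth (A ^ j) (k - i)))"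
    by (simp add: fps_mult_nth sum_distrib_left ac_simps)
  also have "\<dots> \<in> \<int>"
  proof (rule Ints_sum, rule Ints_mult)
    fix i assume "i \<in> {0..k}"
    then show "q * fps_nth A i \<in> \<int>" "q ^ j * fps_nth (A ^ j) (k - i) \<in> \<int>"
      using Suc assms(1) by auto
  qed
  finally show ?case .
qed

text \<open>The product of the reduced denominators is a common denominator; it may exceed the least
  one, but its logarithm is at most \<open>m\<close> times that of the largest denominator. Index 0
  is outside the range of \<open>max_denominator\<close> and is handled by
  \<open>a 0 = 0\<close>.\<close>

lemma prod_denominators:
  fixes a :: "nat \<Rightarrow> rat"
  assumes "a 0 = 0"
  obtains Q :: int where "1 \<le> Q" and "Q \<le> max_denominator a m ^ m"
    and "\<And>k. k \<le> m \<Longrightarrow> of_int Q * (of_rat (a k) :: 'a :: field_char_0) \<in> \<int>"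
proof -
  define q where "q k = snd (quotient_of (a k))" for k
  have pos: "0 < q k" for k unfolding q_def by (rule quotient_of_denom_pos')
  define Q where "Q = (\<Prod>k\<in>{1..m}. q k)"
  have "0 < Q" unfolding Q_def using pos by (intro prod_pos) auto
  moreover have "Q \<le> max_denominator a m ^ m"
  proof -
    have "Q \<le> (\<Prod>k\<in>{1..m}. max_denominator a m)"
      unfolding Q_def using pos
      by (intro prod_mono) (auto intro!: Max_ge simp: max_denominator_def q_def less_imp_le)
    then show ?thesis by simp
  qed
  moreover have "of_int Q * (of_rat (a k) :: 'a) \<in> \<int>" if "k \<le> m" for k
  proof (cases "k = 0")
    case True
    then show ?thesis by (simp add: assms)
  next
    case False
    then have "q k dvd Q" unfolding Q_def using that by (intro dvd_prodI) auto
    then obtain t where t: "Q = q k * t" by blast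
    have "a k = of_int (fst (quotient_of (a k))) / of_int (q k)"
      unfolding q_def by (rule quotient_of_div) simp
    then have "of_int (q k) * a k = of_int (fst (quotient_of (a k)))"
      using pos[of k] by (simp add: field_simps)
    then have "of_rat (of_int (q k) * a k) = (of_int (fst (quotient_of (a k))) :: 'a)" by simp
    then have "of_int (q k) * (of_rat (a k) :: 'a) = of_int (fst (quotient_of (a k)))"
      by (simp add: of_rat_mult)
    then have "of_int Q * (of_rat (a k) :: 'a) = of_int (t * fst (quotient_of (a k)))"
      by (simp add: t ac_simps)
    then show ?thesis by simp
  qed
  ultimately show ?thesis by (intro that[of Q]) auto
qed

section \<open>Bivariate polynomials as coefficient families on a square\<close>

text \<open>The degree is at most \<open>d\<close> in each variable separately, as in
  \<open>max_zero_count\<close>, so the total degree can reach \<open>2 * d\<close>. A coefficient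
  family, unlike a nested polynomial, serves directly as the unknown vector of a linear
  system.\<close>

definition bipoly_eval :: "(complex \<Rightarrow> complex) \<Rightarrow> nat \<Rightarrow> (nat \<times> nat \<Rightarrow> complex) \<Rightarrow> complex \<Rightarrow> complex" where
  "bipoly_eval f d c z = (\<Sum>(i, j)\<in>{..d} \<times> {..d}. c (i, j) * (z ^ i * f z ^ j))"

definition bipoly_fps :: "complex fps \<Rightarrow> nat \<Rightarrow> (nat \<times> nat \<Rightarrow> complex) \<Rightarrow> complex fps" where
  "bipoly_fps A d c = (\<Sum>(i, j)\<in>{..d} \<times> {..d}. fps_const (c (i, j)) * (fps_X ^ i * A ^ j))"

lemma has_fps_expansion_bipoly_eval:
  "f has_fps_expansion A \<Longrightarrow> bipoly_eval f d c has_fps_expansion bipoly_fps A d c"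
  unfolding bipoly_eval_def[abs_def] bipoly_fps_def case_prod_unfold
  by (intro has_fps_expansion_sum has_fps_expansion_cmult_left has_fps_expansion_mult
      has_fps_expansion_power has_fps_expansion_fps_X)

lemma bipoly_eval_eq_sum_poly:
  assumes "\<And>j. j \<le> d \<Longrightarrow> degree (p j) \<le> d"
  shows "bipoly_eval f d (\<lambda>(i, j). coeff (p j) i) z = (\<Sum>j\<le>d. poly (p j) z * f z ^ j)"
proof -
  have "poly (p j) z = (\<Sum>i\<le>d. coeff (p j) i * z ^ i)" if "j \<le> d" for j
    using poly_as_sum_of_monoms'[OF assms[OF that]]
    by (metis (mono_tags, lifting) poly_monom poly_sum sum.cong)
  then have "(\<Sum>j\<le>d. poly (p j) z * f z ^ j) = (\<Sum>j\<le>d. \<Sum>i\<le>d. coeff (p j) i * (z ^ i * f z ^ j))"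
    by (simp add: sum_distrib_right mult.assoc)
  also have "\<dots> = (\<Sum>i\<le>d. \<Sum>j\<le>d. coeff (p j) i * (z ^ i * f z ^ j))" by (rule sum.swap)
  finally show ?thesis by (simp add: bipoly_eval_def sum.cartesian_product)
qed

text \<open>Injectivity of the truncated Taylor map: a nonzero family would give a nonzero
  polynomial of total degree at most \<open>2 * d\<close> whose order of vanishing exceeds
  \<open>m\<close>.\<close>

lemma coeff_eq_0_of_bipoly_fps_vanishing:
  assumes A: "f has_fps_expansion A" and ti: "transcendence_index f (2 * d) \<le> enat m"
    and zero: "\<And>k. k \<le> m \<Longrightarrow> fps_nth (bipoly_fps A d c) k = 0" and ij: "i \<le> d" "j \<le> d"
  shows "c (i, j) = 0"
proof (rule ccontr)
  assume nz: "c (i, j) \<noteq> 0"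
  define p where "p j = (\<Sum>i\<le>d. monom (c (i, j)) i)" for j
  define P where "P = (\<Sum>j\<le>d. monom (p j) j)"
  have coeff_p: "coeff (p j) i = (if i \<le> d then c (i, j) else 0)" for i j
    by (simp add: p_def coeff_sum)
  have coeff_P: "coeff P j = (if j \<le> d then p j else 0)" for j
    by (simp add: P_def coeff_sum)
  have "P \<noteq> 0" using nz ij coeff_p coeff_P by (metis coeff_0)
  moreover have "total_degree_le P (2 * d)"
    by (auto simp: total_degree_le_def coeff_P coeff_p split: if_splits)
  moreover have "poly (poly P [:f z:]) z = bipoly_eval f d c z" for z
  proof -
    have "poly (poly P [:f z:]) z = (\<Sum>j\<le>d. poly (p j) z * f z ^ j)"
      by (simp add: P_def poly_sum poly_monom poly_power)
    also have "\<dots> = bipoly_eval f d (\<lambda>(i, j). coeff (p j) i) z"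
      by (rule bipoly_eval_eq_sum_poly[symmetric]) (auto simp: coeff_p intro!: degree_le)
    also have "\<dots> = bipoly_eval f d c z"
      unfolding bipoly_eval_def by (intro sum.cong refl) (auto simp: coeff_p)
    finally show ?thesis .
  qed
  ultimately have "vanishing_order (bipoly_eval f d c) 0 \<le> transcendence_index f (2 * d)"
    unfolding transcendence_index_def by (intro SUP_upper2[of P]) simp_all
  then have "vanishing_order (bipoly_eval f d c) 0 \<le> enat m" using ti by simp
  then have "bipoly_fps A d c \<noteq> 0" and "subdegree (bipoly_fps A d c) \<le> m"
    by (auto simp: vanishing_order_eq_subdegree[OF has_fps_expansion_bipoly_eval[OF A]] split: if_splits)
  then show False using zero nth_subdegree_nonzero by blast
qed

section \<open>Coefficients controlled by finitely many Taylor coefficients\<close>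

text \<open>This is \<open>integer_system_bound\<close> for the Taylor map scaled by
  \<open>Q ^ d\<close>, with \<open>n\<close> unknowns and \<open>m + 1\<close> equations. The last
  \<open>H\<^sup>2\<close> arises because the scaling enlarges both the entries and the right-hand
  sides; the first factor \<open>n\<close> comes from summing over the unknowns.\<close>

lemma sum_norm_coeffs_le:
  fixes f :: "complex \<Rightarrow> complex" and Q :: int
  assumes A: "f has_fps_expansion A"
    and f: "f holomorphic_on ball 0 1" "continuous_on (cball 0 1) f"
    and f1: "\<And>z. z \<in> cball 0 1 \<Longrightarrow> norm (f z) \<le> 1"
    and ti: "transcendence_index f (2 * d) \<le> enat m"
    and Q: "1 \<le> Q" "\<And>k. k \<le> m \<Longrightarrow> of_int Q * fps_nth A k \<in> \<int>"
    and \<beta>: "\<And>k. k \<le> m \<Longrightarrow> norm (fps_nth (bipoly_fps A d c) k) \<le> \<beta>"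
  defines "n \<equiv> (d + 1)\<^sup>2"
  defines "H \<equiv> real_of_int Q ^ d"
  shows "(\<Sum>ij\<in>{..d} \<times> {..d}. norm (c ij))
    \<le> real n * (real n * (fact n * (real (m + 1) * H\<^sup>2) ^ n) * (real (m + 1) * H\<^sup>2)) * \<beta>"
proof -
  define I where "I = {..d} \<times> {..d}"
  have card_I: "finite I" "card I = n" by (auto simp: I_def n_def power2_eq_square)
  then obtain h where h: "bij_betw h {..<n} I"
    using ex_bij_betw_nat_finite[of I] by (metis atLeast0LessThan)
  define t where "t ij k = fps_nth (fps_X ^ fst ij * A ^ snd ij) k" for ij k
  have t_int: "of_int (Q ^ d) * t ij k \<in> \<int>" if "ij \<in> I" "k \<le> m" for ij k
  proof -
    obtain i j where [simp]: "ij = (i, j)" and "j \<le> d" using \<open>ij \<in> I\<close> by (auto simp: I_def)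
    have "(of_int Q) ^ j * fps_nth (A ^ j) (k - i) \<in> \<int>"
      by (rule fps_nth_power_Ints[of m]) (use Q(2) \<open>k \<le> m\<close> in auto)
    \<comment> \<open>Padding the exponent to \<open>d\<close> gives one multiplier for all
      columns.\<close>
    then have "(of_int Q) ^ (d - j) * ((of_int Q) ^ j * fps_nth (A ^ j) (k - i)) \<in> \<int>"
      by (rule Ints_mult[rotated]) auto
    moreover have "of_int (Q ^ d) = (of_int Q :: complex) ^ (d - j) * of_int Q ^ j"
      using \<open>j \<le> d\<close> by (simp flip: power_add)
    ultimately have "of_int (Q ^ d) * fps_nth (A ^ j) (k - i) \<in> \<int>"
      by (simp only: mult.assoc)
    \<comment> \<open>For \<open>k < i\<close> the shifted coefficient is 0, so the truncated
      difference \<open>k - i\<close> is harmless.\<close>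
    then show ?thesis by (simp add: t_def fps_X_power_mult_nth)
  qed
  have t_le: "norm (t ij k) \<le> 1" for ij k
  proof -
    have "(\<lambda>z. z ^ fst ij * f z ^ snd ij) has_fps_expansion fps_X ^ fst ij * A ^ snd ij"
      by (intro has_fps_expansion_mult has_fps_expansion_power has_fps_expansion_fps_X A)
    then have "norm (t ij k) \<le> 1 / 1 ^ k"
      unfolding t_def
      by (rule norm_fps_nth_le)
        (auto intro!: holomorphic_intros continuous_intros f mult_le_one power_le_one f1
          simp: norm_mult norm_power)
    then show ?thesis by simp
  qed
  define U where "U q k = (SOME u :: int. of_int u = of_int (Q ^ d) * t (h q) k)" for q k
  have h_mem: "h q \<in> I" if "q < n" for q using h that by (auto simp: bij_betw_def)
  have U: "of_int (U q k) = of_int (Q ^ d) * t (h q) k" if "q < n" "k < m + 1" for q k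
  proof -
    have "\<exists>u :: int. of_int u = of_int (Q ^ d) * t (h q) k"
      using t_int[OF h_mem[OF that(1)], of k] that(2) by (auto simp: Ints_def)
    then show ?thesis unfolding U_def by (rule someI_ex)
  qed
  have U_sum: "(\<Sum>q<n. of_int (U q k) * x (h q)) = of_int (Q ^ d) * fps_nth (bipoly_fps A d x) k"
    if "k < m + 1" for k x
  proof -
    have "(\<Sum>q<n. of_int (U q k) * x (h q)) = (\<Sum>q<n. of_int (Q ^ d) * (x (h q) * t (h q) k))"
      using that by (intro sum.cong) (auto simp: U)
    also have "\<dots> = (\<Sum>ij\<in>I. of_int (Q ^ d) * (x ij * t ij k))"
      by (rule sum.reindex_bij_betw[OF h])
    also have "\<dots> = of_int (Q ^ d) * fps_nth (bipoly_fps A d x) k"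
      by (simp add: bipoly_fps_def I_def t_def fps_sum_nth sum_distrib_left case_prod_unfold)
    finally show ?thesis .
  qed
  have c_le: "norm (c (h q)) \<le> real n * (fact n * (real (m + 1) * real_of_int (Q ^ d) ^ 2) ^ n)
      * (real (m + 1) * real_of_int (Q ^ d) * (H * \<beta>))" if "q < n" for q
  proof (rule integer_system_bound[where U = U and x = "\<lambda>q. c (h q)"])
    fix v :: "nat \<Rightarrow> complex" and q
    assume v: "\<And>k. k < m + 1 \<Longrightarrow> (\<Sum>q<n. of_int (U q k) * v q) = 0" and "q < n"
    define x where "x ij = v (the_inv_into {..<n} h ij)" for ij
    have x: "x (h q) = v q" if "q < n" for q
      using that h by (simp add: x_def bij_betw_def the_inv_into_f_f)
    have zero: "fps_nth (bipoly_fps A d x) k = 0" if "k \<le> m" for k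
    proof -
      have "of_int (Q ^ d) * fps_nth (bipoly_fps A d x) k = (\<Sum>q<n. of_int (U q k) * x (h q))"
        using that by (subst U_sum) auto
      also have "\<dots> = (\<Sum>q<n. of_int (U q k) * v q)" by (intro sum.cong) (auto simp: x)
      also have "\<dots> = 0" using v that by simp
      finally show ?thesis using Q(1) by simp
    qed
    have "fst (h q) \<le> d" "snd (h q) \<le> d" using h_mem[OF \<open>q < n\<close>] by (auto simp: I_def)
    then have "x (fst (h q), snd (h q)) = 0"
      using coeff_eq_0_of_bipoly_fps_vanishing[OF A ti zero] by blast
    then show "v q = 0" using x[OF \<open>q < n\<close>] by simp
  next
    fix q k assume qk: "q < n" "k < m + 1"
    have "norm (of_int (U q k) :: complex) \<le> real_of_int (Q ^ d) * 1"
      unfolding U[OF qk] norm_mult using t_le[of "h q" k] Q(1)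
      by (intro mult_mono) (auto simp: norm_power)
    then have "real_of_int \<bar>U q k\<bar> \<le> real_of_int (Q ^ d)" by simp
    then show "\<bar>U q k\<bar> \<le> Q ^ d" by (simp only: of_int_le_iff)
  next
    show "1 \<le> Q ^ d" using Q(1) by simp
    fix k assume k: "k < m + 1"
    have "norm (\<Sum>q<n. of_int (U q k) * c (h q)) = H * norm (fps_nth (bipoly_fps A d c) k)"
      unfolding U_sum[OF k] using Q(1) by (simp add: norm_mult norm_power H_def)
    also have "\<dots> \<le> H * \<beta>"
      using \<beta> k Q(1) by (intro mult_left_mono) (auto simp: H_def)
    finally show "norm (\<Sum>q<n. of_int (U q k) * c (h q)) \<le> H * \<beta>" .
  qed (use that in auto)
  have "(\<Sum>ij\<in>I. norm (c ij)) = (\<Sum>q<n. norm (c (h q)))"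
    by (rule sum.reindex_bij_betw[OF h, symmetric])
  also have "\<dots> \<le> (\<Sum>q<n. real n * (fact n * (real (m + 1) * real_of_int (Q ^ d) ^ 2) ^ n)
      * (real (m + 1) * real_of_int (Q ^ d) * (H * \<beta>)))"
    by (intro sum_mono) (use c_le in simp)
  finally show ?thesis
    by (simp add: I_def H_def power2_eq_square ac_simps)
qed

section \<open>Polynomial growth of the logarithms of the constants\<close>

lemma poly_mono_of_nonneg_coeffs:
  fixes p :: "'a :: linordered_idom poly"
  assumes "\<And>i. 0 \<le> coeff p i" and "0 \<le> x" and "x \<le> y"
  shows "poly p x \<le> poly p y"
  unfolding poly_altdef using assms by (intro sum_mono mult_left_mono power_mono) auto

lemma positive_coeffs_nonneg: "positive_coeffs p \<Longrightarrow> 0 \<le> coeff p i"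
  by (cases "i \<le> degree p") (auto simp: positive_coeffs_def coeff_eq_0 less_imp_le)

lemma fact_le_exp: "fact n \<le> exp (real n ^ 2)"
proof -
  have "(fact n :: real) \<le> real n ^ n" by (metis fact_le_power of_nat_fact of_nat_le_iff of_nat_power order_refl)
  also have "\<dots> \<le> exp (real n) ^ n"
  proof (rule power_mono)
    show "real n \<le> exp (real n)" using exp_ge_add_one_self[of "real n"] by linarith
  qed simp
  also have "\<dots> = exp (real n ^ 2)" by (simp add: power2_eq_square flip: exp_of_nat_mult)
  finally show ?thesis .
qed

text \<open>Every factor is replaced by an exponential, using \<open>x \<le> exp x\<close>,
  \<open>fact n \<le> exp (n ^ 2)\<close> and \<open>4 \<le> exp 2\<close>; the exponents then add
  up to a polynomial expression in \<open>n\<close>, \<open>m\<close> and \<open>L\<close>.\<close>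

lemma constants_le_exp:
  fixes n m :: nat and H L :: real
  assumes H: "0 \<le> H" "H \<le> exp L"
  shows "real n * (real n * (fact n * (real (m + 1) * H\<^sup>2) ^ n) * (real (m + 1) * H\<^sup>2)) * 4 ^ m
    \<le> exp (2 * real n + real n ^ 2 + (real n + 1) * (real m + 1 + 2 * L) + 2 * real m)"
proof -
  have n: "real n \<le> exp (real n)" and m: "real (m + 1) \<le> exp (real (m + 1))"
    using exp_ge_add_one_self[of "real n"] exp_ge_add_one_self[of "real (m + 1)"] by linarith+
  have "H\<^sup>2 \<le> (exp L)\<^sup>2" using H by (intro power_mono)
  then have mH: "real (m + 1) * H\<^sup>2 \<le> exp (real m + 1 + 2 * L)"
    using mult_mono[OF m \<open>H\<^sup>2 \<le> (exp L)\<^sup>2\<close>] by (simp add: exp_add ac_simps flip: exp_double)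
  have "(4 :: real) \<le> exp 1 ^ 2"
    using power_mono[of 2 "exp (1 :: real)" 2] exp_ge_add_one_self[of 1] by simp
  then have "(4 :: real) \<le> exp 2" by (simp flip: exp_double)
  then have "(4 :: real) ^ m \<le> exp 2 ^ m" by (intro power_mono) auto
  then have four: "(4 :: real) ^ m \<le> exp (2 * real m)"
    by (simp add: mult.commute flip: exp_of_nat_mult)
  have "(real (m + 1) * H\<^sup>2) ^ n \<le> exp (real m + 1 + 2 * L) ^ n"
    using mH by (intro power_mono) auto
  then have mHn: "(real (m + 1) * H\<^sup>2) ^ n \<le> exp (real n * (real m + 1 + 2 * L))"
    by (simp flip: exp_of_nat_mult)
  have "real n * (real n * (fact n * (real (m + 1) * H\<^sup>2) ^ n) * (real (m + 1) * H\<^sup>2)) * 4 ^ m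
     \<le> exp (real n) * (exp (real n) * (exp (real n ^ 2) * exp (real n * (real m + 1 + 2 * L)))
        * exp (real m + 1 + 2 * L)) * exp (2 * real m)"
    using n mH mHn four fact_le_exp[of n] by (intro mult_mono) auto
  also have "\<dots> = exp (2 * real n + real n ^ 2 + (real n + 1) * (real m + 1 + 2 * L) + 2 * real m)"
    by (simp add: algebra_simps flip: exp_add)
  finally show ?thesis .
qed

section \<open>The zero estimate for a single polynomial in \<open>z\<close> and
  \<open>f z\<close>\<close>

lemma zero_count_le:
  fixes f :: "complex \<Rightarrow> complex" and Q :: int
  assumes A: "f has_fps_expansion A"
    and f: "f holomorphic_on ball 0 1" "continuous_on (cball 0 1) f"
    and f1: "\<And>z. z \<in> cball 0 1 \<Longrightarrow> norm (f z) \<le> 1"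
    and ti: "transcendence_index f (2 * d) \<le> enat m"
    and Q: "1 \<le> Q" "\<And>k. k \<le> m \<Longrightarrow> of_int Q * fps_nth A k \<in> \<int>" "real_of_int Q \<le> exp L"
    and nz: "c (i, j) \<noteq> 0" "i \<le> d" "j \<le> d"
  shows "\<exists>N. zero_count (bipoly_eval f d c) (cball 0 (1/4)) = enat N
    \<and> real N \<le> 5 * (2 * real ((d + 1)\<^sup>2) + real ((d + 1)\<^sup>2) ^ 2
        + (real ((d + 1)\<^sup>2) + 1) * (real m + 1 + 2 * (real d * L)) + 2 * real m)"
proof -
  define F where "F = bipoly_eval f d c"
  define E where "E = bipoly_fps A d c"
  define C where "C = (\<Sum>ij\<in>{..d} \<times> {..d}. norm (c ij))"
  define n where "n = (d + 1)\<^sup>2"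
  define H where "H = real_of_int Q ^ d"
  define K where "K = real n * (real n * (fact n * (real (m + 1) * H\<^sup>2) ^ n) * (real (m + 1) * H\<^sup>2))"
  have "norm (c (i, j)) \<le> C"
    unfolding C_def by (rule member_le_sum) (use nz in auto)
  then have C_pos: "0 < C" using nz(1) by (smt (verit) zero_less_norm_iff)
  have E: "F has_fps_expansion E"
    unfolding F_def E_def by (rule has_fps_expansion_bipoly_eval[OF A])
  have C_le: "C \<le> K * \<beta>" if "\<And>k. k \<le> m \<Longrightarrow> norm (fps_nth E k) \<le> \<beta>" for \<beta>
    using sum_norm_coeffs_le[OF A f f1 ti Q(1,2), of c \<beta>] that
    by (simp add: C_def K_def H_def n_def E_def)
  have F_holo: "F holomorphic_on ball 0 1"
    unfolding F_def bipoly_eval_def[abs_def] case_prod_unfold by (intro holomorphic_intros f)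
  have F_le: "norm (F z) \<le> C" if "z \<in> ball 0 1" for z
  proof -
    have "norm (F z) \<le> (\<Sum>ij\<in>{..d} \<times> {..d}. norm (c ij) * (norm z ^ fst ij * norm (f z) ^ snd ij))"
      unfolding F_def bipoly_eval_def case_prod_unfold
      by (rule order_trans[OF norm_sum]) (simp add: norm_mult norm_power)
    also have "\<dots> \<le> (\<Sum>ij\<in>{..d} \<times> {..d}. norm (c ij) * 1)"
      using that f1[of z] by (intro sum_mono mult_left_mono mult_le_one power_le_one) auto
    finally show ?thesis by (simp add: C_def)
  qed
  \<comment> \<open>If \<open>F\<close> vanished on the disc, \<open>C_le\<close> with
    \<open>\<beta> = 0\<close> would force \<open>C = 0\<close>.\<close>
  have F_nz: "\<exists>w\<in>ball 0 1. F w \<noteq> 0"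
  proof (rule ccontr)
    assume "\<not> (\<exists>w\<in>ball 0 1. F w \<noteq> 0)"
    then have "eventually (\<lambda>w. F w = 0) (nhds 0)"
      by (intro eventually_mono[OF eventually_nhds_in_open[of "ball 0 1"]]) auto
    then have "vanishing_order F 0 = \<infinity>" by (simp add: vanishing_order_def)
    then have "E = 0" using vanishing_order_eq_subdegree[OF E] by (auto split: if_splits)
    then have "C \<le> K * 0" by (intro C_le) auto
    with C_pos show False by simp
  qed
  define Z where "Z = {z \<in> cball 0 (1/4). F z = 0}"
  have Z_ball: "Z \<subseteq> ball 0 1" by (auto simp: Z_def)
  have fin: "finite Z"
  proof (cases "F constant_on ball 0 1")
    case True
    then have "Z = {}" using F_nz Z_ball by (auto simp: constant_on_def Z_def)
    then show ?thesis by simp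
  next
    case False
    have "cball 0 (1/4) \<subseteq> ball (0 :: complex) 1" by auto
    then show ?thesis
      unfolding Z_def
      by (rule holomorphic_compact_finite_zeros[OF F_holo open_ball connected_ball compact_cball _ False])
  qed
  \<comment> \<open>The zeros of \<open>F\<close> are isolated, which excludes the infinite branch
    of \<open>vanishing_order\<close>.\<close>
  have order: "vanishing_order F z = enat (nat (zorder F z))" if "z \<in> Z" for z
  proof -
    obtain v where "v \<in> ball 0 1" "F v \<noteq> 0" using F_nz by blast
    then have "eventually (\<lambda>w. F w \<noteq> 0 \<and> w \<in> ball 0 1) (at z)"
      using that Z_ball by (intro non_zero_neighbour_alt[OF F_holo]) auto
    then have "eventually (\<lambda>w. F w \<noteq> 0) (at z)" by (rule eventually_mono) simp
    then have "\<not> eventually (\<lambda>w. F w = 0) (at z)"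
      by (auto dest: eventually_conj)
    then show ?thesis
      by (auto simp: vanishing_order_def eventually_nhds_conv_at)
  qed
  define N where "N = (\<Sum>z\<in>Z. nat (zorder F z))"
  have "zero_count F (cball 0 (1/4)) = (\<Sum>z\<in>Z. vanishing_order F z)"
    using fin by (simp add: zero_count_def Z_def)
  also have "\<dots> = (\<Sum>z\<in>Z. of_nat (nat (zorder F z)))"
    by (intro sum.cong) (auto simp: order of_nat_eq_enat)
  also have "\<dots> = of_nat N" by (simp add: N_def)
  finally have count: "zero_count F (cball 0 (1/4)) = enat N" by (simp only: of_nat_eq_enat)

  have small: "norm (F z) \<le> C * (4/5) ^ N" if "z \<in> cball 0 (1/4)" for z
    unfolding N_def
    by (rule norm_le_zeros[OF F_holo F_nz F_le fin _ that]) (auto simp: Z_def)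
  \<comment> \<open>The upper bound for the Taylor coefficients is itself proportional to
    \<open>C\<close>, so the positive number \<open>C\<close> cancels and only \<open>N\<close>,
    \<open>K\<close> and \<open>m\<close> remain.\<close>
  have "C \<le> K * (C * (4/5) ^ N * 4 ^ m)"
  proof (rule C_le)
    fix k assume "k \<le> m"
    have "norm (fps_nth E k) \<le> C * (4/5) ^ N / (1/4) ^ k"
    proof (rule norm_fps_nth_le[OF E])
      show "F holomorphic_on ball 0 (1/4)" by (rule holomorphic_on_subset[OF F_holo]) auto
      show "continuous_on (cball 0 (1/4)) F"
        by (rule continuous_on_subset[OF holomorphic_on_imp_continuous_on[OF F_holo]]) auto
    qed (use small in auto)
    also have "\<dots> = C * (4/5) ^ N * 4 ^ k" by (simp add: power_one_over)
    also have "\<dots> \<le> C * (4/5) ^ N * 4 ^ m"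
      using \<open>k \<le> m\<close> C_pos by (intro mult_left_mono power_increasing) auto
    finally show "norm (fps_nth E k) \<le> C * (4/5) ^ N * 4 ^ m" .
  qed
  then have "C * 1 \<le> C * ((4/5) ^ N * (K * 4 ^ m))" by (simp add: ac_simps)
  then have "1 \<le> (4/5) ^ N * (K * 4 ^ m)" using C_pos by (simp only: mult_le_cancel_left_pos)
  then have main: "(5/4) ^ N \<le> K * 4 ^ m" by (simp add: power_divide field_simps)
  \<comment> \<open>Equivalent to \<open>1 - 1/5 \<le> exp (- (1/5))\<close>; this is the source of
    the factor 5 in the bound for \<open>N\<close>.\<close>
  have "exp (1/5) \<le> (5/4 :: real)"
    using exp_ge_add_one_self[of "- (1/5) :: real"] by (simp add: exp_minus field_simps)
  then have "exp (1/5) ^ N \<le> (5/4 :: real) ^ N" by (intro power_mono) auto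
  then have "exp (real N / 5) \<le> (5/4) ^ N" by (simp flip: exp_of_nat_mult)
  also note main
  also have "K * 4 ^ m \<le> exp (2 * real n + real n ^ 2 + (real n + 1) * (real m + 1 + 2 * (real d * L)) + 2 * real m)"
    unfolding K_def
  proof (rule constants_le_exp)
    have "H \<le> exp L ^ d" unfolding H_def using Q by (intro power_mono) auto
    then show "H \<le> exp (real d * L)" by (simp add: exp_of_nat_mult)
  qed (use Q(1) in \<open>simp add: H_def\<close>)
  finally have "real N / 5 \<le> 2 * real n + real n ^ 2 + (real n + 1) * (real m + 1 + 2 * (real d * L)) + 2 * real m"
    by simp
  with count show ?thesis by (auto simp: F_def n_def)
qed

section \<open>Choice of the polynomial \<open>T\<close>, uniform in \<open>d\<close>\<close>

theorem theorem3p2p8: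
  fixes f :: "complex \<Rightarrow> complex" and a :: "nat \<Rightarrow> rat" and R S :: "real poly"
  assumes "f analytic_on cball 0 1"
    and "transcendental_on f (cball 0 1)"
    and "\<forall>z\<in>cball 0 1. (\<lambda>k. of_rat (a k) * z ^ k) sums f z"
    and "f 0 = 0"
    and "\<forall>z\<in>cball 0 1. norm (f z) \<le> 1"
    and "positive_coeffs R" and "positive_coeffs S"
    and "\<forall>d\<ge>1. ereal_of_enat (transcendence_index f d) \<le> ereal (poly R (real d))"
    and "\<forall>l\<ge>1. real_of_int (max_denominator a l) \<le> exp (poly S (real l))"
  shows "\<exists>T :: real poly. \<forall>d\<ge>1. ereal_of_enat (max_zero_count f d) \<le> ereal (poly T (real d))"
proof -
  define A :: "complex fps" where "A = Abs_fps (\<lambda>k. of_rat (a k))"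
  have A: "f has_fps_expansion A"
  proof (rule has_fps_expansionI)
    have "eventually (\<lambda>z. z \<in> cball 0 1) (nhds (0 :: complex))"
      by (rule eventually_mono[OF eventually_nhds_in_open[of "ball 0 1"]]) auto
    then show "eventually (\<lambda>u. (\<lambda>n. fps_nth A n * u ^ n) sums f u) (nhds 0)"
      by eventually_elim (use assms(3) in \<open>simp add: A_def\<close>)
  qed
  have f: "f holomorphic_on ball 0 1" "continuous_on (cball 0 1) f"
    using analytic_imp_holomorphic[OF assms(1)]
    by (auto intro: holomorphic_on_subset[OF _ ball_subset_cball] holomorphic_on_imp_continuous_on)
  have "(\<lambda>k. of_rat (a k) * 0 ^ k) sums f 0" using assms(3)[rule_format, of 0] by simp
  then have "of_rat (a 0) = f 0" by (rule sums_unique2[OF powser_sums_zero])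
  then have a0: "a 0 = 0" using assms(4) by simp

  \<comment> \<open>At \<open>d\<close>, \<open>M\<close> bounds the integer \<open>m\<close>
    obtained by rounding up \<open>R(2d)\<close>, \<open>V\<close> bounds \<open>m * S(m)\<close>
    and hence \<open>ln Q\<close>, and \<open>W\<close> equals the number
    \<open>(d + 1)\<^sup>2\<close> of unknowns. \<open>T\<close> is the bound of
    \<open>zero_count_le\<close> with these inserted.\<close>
  define M where "M = pcompose R [:0, 2:] + 1"
  define V where "V = M * pcompose S M"
  define W :: "real poly" where "W = [:1, 1:] ^ 2"
  define T where "T = 5 * (2 * W + W ^ 2 + (W + 1) * (M + 1 + 2 * ([:0, 1:] * V)) + 2 * M)"
  have "ereal_of_enat (max_zero_count f d) \<le> ereal (poly T (real d))" if d: "d \<ge> 1" for d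
  proof -
    define m where "m = nat \<lceil>poly R (real (2 * d))\<rceil>"
    \<comment> \<open>Positivity of \<open>R\<close> makes \<open>m\<close> at least 1, so the
      maximum defining \<open>max_denominator a m\<close> is over a nonempty set.\<close>
    have R0: "poly R 0 > 0"
      using assms(6) by (simp add: positive_coeffs_def poly_0_coeff_0)
    then have R_pos: "poly R (real (2 * d)) > 0"
      using poly_mono_of_nonneg_coeffs[OF positive_coeffs_nonneg[OF assms(6)], of 0 "real (2 * d)"] by simp
    have "poly M (real d) = poly R (real (2 * d)) + 1"
      by (simp add: M_def poly_pcompose mult.commute)
    then have m: "1 \<le> m" "poly R (real (2 * d)) \<le> real m" "real m \<le> poly M (real d)"
      using R_pos unfolding m_def by linarith+
    have "ereal_of_enat (transcendence_index f (2 * d)) \<le> ereal (poly R (real (2 * d)))"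
      using d by (intro assms(8)[rule_format]) simp
    also have "\<dots> \<le> ereal_of_enat (enat m)" using m by simp
    finally have ti: "transcendence_index f (2 * d) \<le> enat m"
      by (simp only: ereal_of_enat_le_iff)
    obtain Q :: int where Q: "1 \<le> Q" "Q \<le> max_denominator a m ^ m"
      "\<And>k. k \<le> m \<Longrightarrow> of_int Q * (of_rat (a k) :: complex) \<in> \<int>"
      using prod_denominators[of a m, OF a0] by metis
    have Sm: "0 \<le> poly S (real m)" "poly S (real m) \<le> poly S (poly M (real d))"
      using poly_mono_of_nonneg_coeffs[OF positive_coeffs_nonneg[OF assms(7)], of "real m" "poly M (real d)"] m(3)
        poly_mono_of_nonneg_coeffs[OF positive_coeffs_nonneg[OF assms(7)], of 0 "real m"]
        positive_coeffs_nonneg[OF assms(7), of 0]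
      by (auto simp: poly_0_coeff_0)
    have Q_le: "real_of_int Q \<le> exp (real m * poly S (real m))"
    proof -
      have "0 \<le> max_denominator a m"
        unfolding max_denominator_def using m(1) quotient_of_denom_pos'[of "a 1"]
        by (intro Max_ge[THEN order.trans[rotated], of _ "snd (quotient_of (a 1))"]) (auto simp: less_imp_le)
      have "real_of_int Q \<le> real_of_int (max_denominator a m) ^ m"
        using Q(2) by (metis of_int_le_iff of_int_power)
      also have "\<dots> \<le> exp (poly S (real m)) ^ m"
        using assms(9) m(1) \<open>0 \<le> max_denominator a m\<close> by (intro power_mono) auto
      finally show ?thesis by (simp add: exp_of_nat_mult)
    qed
    define B where "B = 5 * (2 * real ((d + 1)\<^sup>2) + real ((d + 1)\<^sup>2) ^ 2
        + (real ((d + 1)\<^sup>2) + 1) * (real m + 1 + 2 * (real d * (real m * poly S (real m)))) + 2 * real m)"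
    have B0: "0 \<le> B" unfolding B_def using Sm(1) by (intro mult_nonneg_nonneg add_nonneg_nonneg) auto
    have "B \<le> poly T (real d)"
    proof -
      have "real m * poly S (real m) \<le> poly V (real d)"
        unfolding V_def poly_mult poly_pcompose using Sm m(3) by (intro mult_mono) auto
      moreover have "poly T (real d) = 5 * (2 * real ((d + 1)\<^sup>2) + real ((d + 1)\<^sup>2) ^ 2
          + (real ((d + 1)\<^sup>2) + 1) * (poly M (real d) + 1 + 2 * (real d * poly V (real d))) + 2 * poly M (real d))"
        by (simp add: T_def W_def add.commute)
      ultimately show ?thesis
        unfolding B_def using m(3)
        by (simp only:) (intro add_mono mult_left_mono order_refl of_nat_0_le_iff; simp)
    qed
    have "max_zero_count f d \<le> enat (nat \<lfloor>B\<rfloor>)"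
      unfolding max_zero_count_def
    proof (rule SUP_least, clarify)
      fix p :: "nat \<Rightarrow> complex poly" and j
      assume p: "\<forall>j\<le>d. degree (p j) \<le> d" and j: "j \<le> d" "p j \<noteq> 0"
      have "(\<lambda>z. \<Sum>j\<le>d. poly (p j) z * f z ^ j) = bipoly_eval f d (\<lambda>(i, j). coeff (p j) i)"
        using bipoly_eval_eq_sum_poly[of d p f] p by auto
      moreover have "\<exists>N. zero_count (bipoly_eval f d (\<lambda>(i, j). coeff (p j) i)) (cball 0 (1/4)) = enat N \<and> real N \<le> B"
        unfolding B_def
      proof (rule zero_count_le[OF A f])
        show "norm (f z) \<le> 1" if "z \<in> cball 0 1" for z using assms(5) that by blast
        \<comment> \<open>The nonzero coefficient required is the leading coefficient of the nonzero
          polynomial \<open>p j\<close>.\<close>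
        show "(case (degree (p j), j) of (i, j) \<Rightarrow> coeff (p j) i) \<noteq> 0" using j by simp
        show "degree (p j) \<le> d" "j \<le> d" using p j by auto
        show "of_int Q * fps_nth A k \<in> \<int>" if "k \<le> m" for k using Q(3)[OF that] by (simp add: A_def)
      qed (fact ti Q(1) Q_le)+
      ultimately show "zero_count (\<lambda>z. \<Sum>j\<le>d. poly (p j) z * f z ^ j) (cball 0 (1/4)) \<le> enat (nat \<lfloor>B\<rfloor>)"
        by (auto simp: le_nat_floor)
    qed
    then have "ereal_of_enat (max_zero_count f d) \<le> ereal_of_enat (enat (nat \<lfloor>B\<rfloor>))"
      by (simp only: ereal_of_enat_le_iff)
    also have "\<dots> \<le> ereal B" using B0 by (simp add: of_nat_floor)
    also have "\<dots> \<le> ereal (poly T (real d))" using \<open>B \<le> poly T (real d)\<close> by simp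
    finally show ?thesis .
  qed
  then show ?thesis by blast
qed

end
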